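(* A word $w$ in the letters $x,y$ is contained in $U$ if and only if $w$ is one of the following words, for some $n\in\mathbb{N}=\{0,1,2,\ldots\}$: (a) $x^n$, $y^n$; (b) $(xy)^{n+1}$, $(yx)^{n+1}$, $(xy)^nx$, $(yx)^ny$; (c) $(xxyy)^{n+1}$, $(yyxx)^{n+1}$, $(xxyy)^nxx$, $(yyxx)^nyy$, $xyy(xxyy)^n$, $yxx(yyxx)^n$, $x(yyxx)^n$, $y(xxyy)^n$, $(xxyy)^nxxy$, $(yyxx)^nyyx$, $(xxyy)^nx$, $(yyxx)^ny$, $x(yyxx)^ny$, $y(xxyy)^nx$, $xyy(xxyy)^nx$, $yxx(yyxx)^ny$. Here all powers and juxtapositions are with respect to the free (concatenation) product.
   Context: Let $\mathbb{F}$ be a field of characteristic zero and let $q\in\mathbb{F}$ be nonzero and not a root of unity. Let $\mathbb{V}$ be the free associative unital $\mathbb{F}$-algebra on two noncommuting generators (letters) $x,y$; the words in $x,y$ (including the trivial word $\mathbf{1}$) form a basis of $\mathbb{V}$. The $q$-shuffle product $\star$ on the vector space $\mathbb{V}$ is the bilinear associative product with unit $\mathbf{1}$ determined as follows. Put $\langle x,x\rangle=\langle y,y\rangle=2$ and $\langle x,y\rangle=\langle y,x\rangle=-2$. For nontrivial words $u=u_1\cdots u_r$ and $v=v_1\cdots v_s$, $$u\star v=u_1\big((u_2\cdots u_r)\star v\big)+v_1\big(u\star(v_2\cdots v_s)\big)q^{\langle v_1,u_1\rangle+\cdots+\langle v_1,u_r\rangle}.$$ $U$ denotes the subalgebra of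 $(\mathbb{V},\star)$ generated by $x,y$. *)

theory Defs
  imports Complex_Main "HOL-Library.Poly_Mapping"
begin

text \<open>Words under concatenation form the free monoid, written additively because the library's
  monoid algebra \<open>'m \<Rightarrow>\<^sub>0 'a\<close> takes its exponents from an additive monoid. With this instance,
  multiplication on \<open>'b list \<Rightarrow>\<^sub>0 'a\<close> is the bilinear extension of concatenation, so
  \<open>letter list \<Rightarrow>\<^sub>0 'a\<close> is the free associative unital algebra on two letters.\<close>

instantiation list :: (type) monoid_add
begin

definition zero_list :: "'a list" where "zero_list = []"

definition plus_list :: "'a list \<Rightarrow> 'a list \<Rightarrow> 'a list" where "plus_list u v = u @ v"

instance by standard (simp_all add: zero_list_def plus_list_def)

end

datatype letter = X | Y

type_synonym 'a freealg = "letter list \<Rightarrow>\<^sub>0 'a"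

definition word :: "letter list \<Rightarrow> 'a::field freealg" where
  "word w = Poly_Mapping.single w 1"

definition smult :: "'a::field \<Rightarrow> 'a freealg \<Rightarrow> 'a freealg" where
  "smult c f = Poly_Mapping.map ((*) c) f"

lemma one_freealg: "(1 :: 'a::field freealg) = word []"
  by (simp add: word_def zero_list_def flip: single_one)

lemma word_mult: "word u * word v = (word (u @ v) :: 'a::field freealg)"
  by (simp add: word_def mult_single plus_list_def)

lemma lookup_smult: "Poly_Mapping.lookup (smult c f) w = c * Poly_Mapping.lookup f w"
  by (simp add: smult_def Poly_Mapping.map.rep_eq when_def)

definition pairing :: "letter \<Rightarrow> letter \<Rightarrow> int" where
  "pairing a b = (if a = b then 2 else - 2)"

fun qshuffle_words :: "'a::field \<Rightarrow> letter list \<Rightarrow> letter list \<Rightarrow> 'a freealg" where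
  "qshuffle_words q [] v = word v"
| "qshuffle_words q (a # u) [] = word (a # u)"
| "qshuffle_words q (a # u) (b # v) =
     word [a] * qshuffle_words q u (b # v) +
     smult (q powi (\<Sum>c\<leftarrow>a # u. pairing b c)) (word [b] * qshuffle_words q (a # u) v)"

definition qshuffle :: "'a::field \<Rightarrow> 'a freealg \<Rightarrow> 'a freealg \<Rightarrow> 'a freealg" where
  "qshuffle q f g = (\<Sum>u\<in>Poly_Mapping.keys f. \<Sum>v\<in>Poly_Mapping.keys g.
     smult (Poly_Mapping.lookup f u * Poly_Mapping.lookup g v) (qshuffle_words q u v))"

lemma qshuffle_word_word: "qshuffle q (word u) (word v) = qshuffle_words q u v"
  by (rule poly_mapping_eqI) (simp add: qshuffle_def word_def lookup_smult)

definition qshuffle_subalgebra :: "'a::field \<Rightarrow> 'a freealg set \<Rightarrow> bool" where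
  "qshuffle_subalgebra q S \<longleftrightarrow>
     1 \<in> S \<and>
     (\<forall>f\<in>S. \<forall>g\<in>S. f + g \<in> S) \<and>
     (\<forall>c. \<forall>f\<in>S. smult c f \<in> S) \<and>
     (\<forall>f\<in>S. \<forall>g\<in>S. qshuffle q f g \<in> S)"

definition U :: "'a::field \<Rightarrow> 'a freealg set" where
  "U q = qshuffle_subalgebra q hull {word [X], word [Y]}"

definition wpow :: "letter list \<Rightarrow> nat \<Rightarrow> letter list"  (infixr \<open>^w\<close> 80) where
  "u ^w n = concat (replicate n u)"

end

theory Submission
  imports Defs
begin

text \<open>
  Deleting letters from the left, \<open>\<partial>\<^sub>a f = (u \<mapsto> f (a u))\<close>, is a twisted derivation of the
  \<open>q\<close>-shuffle product, and the cubic \<open>q\<close>-Serre expression in \<open>\<partial>\<^sub>X, \<partial>\<^sub>Y\<close> is again a twisted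
  derivation because all mixed terms cancel. Hence every element of \<open>U\<close> is annihilated by it at each
  position. For a single word this says that no factor of length four contains one letter exactly
  three times, so that the word has period four.

  Conversely, the antipode identity for the deconcatenation coproduct gives, by induction on the
  length, \<open>w \<plusminus> q\<^sup>e rev w \<in> U\<close> for such a word \<open>w\<close>, where \<open>e = (r - s)\<^sup>2 - (r + s)\<close> and \<open>r, s\<close> are the
  numbers of \<open>X\<close> and \<open>Y\<close> in \<open>w\<close>. Applying this to \<open>w\<close> and to \<open>rev w\<close> yields \<open>(1 - q\<^bsup>2e\<^esup>) w \<in> U\<close>, and
  \<open>e \<noteq> 0\<close> for every word of period four under consideration having at least two letters.
\<close>

section \<open>Coefficients and scalar multiples in the free algebra\<close>

lemma lookup_word: "Poly_Mapping.lookup (word u :: 'a::field freealg) w = (if w = u then 1 else 0)"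
  by (auto simp: word_def lookup_single when_def)

lemma lookup_letter_times:
  "Poly_Mapping.lookup (word [a] * f :: 'a::field freealg) w =
     (case w of [] \<Rightarrow> 0 | b # u \<Rightarrow> if a = b then Poly_Mapping.lookup f u else 0)"
proof -
  have "Poly_Mapping.lookup (word [a] * f) w = Sum_any (\<lambda>v. Poly_Mapping.lookup f v when w = [a] + v)"
    by (simp add: word_def times_poly_mapping.rep_eq prod_fun_def lookup_single when_mult)
  also have "\<dots> = (case w of [] \<Rightarrow> 0 | b # u \<Rightarrow> if a = b then Poly_Mapping.lookup f u else 0)"
    by (auto simp: plus_list_def split: list.split)
  finally show ?thesis .
qed

lemma letter_times_word: "word [a] * word u = (word (a # u) :: 'a::field freealg)"
  by (simp add: word_mult)

lemma letter_times_smult: "word [a] * smult c f = smult c (word [a] * f :: 'a::field freealg)"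
  by (rule poly_mapping_eqI) (simp add: lookup_letter_times lookup_smult split: list.split)

lemma smult_smult: "smult c (smult d f) = smult (c * d) (f :: 'a::field freealg)"
  by (rule poly_mapping_eqI) (simp add: lookup_smult)

lemma smult_one: "smult 1 f = (f :: 'a::field freealg)"
  by (rule poly_mapping_eqI) (simp add: lookup_smult)

lemma smult_add_right: "smult c (f + g) = smult c f + smult c (g :: 'a::field freealg)"
  by (rule poly_mapping_eqI) (simp add: lookup_smult lookup_add algebra_simps)

lemma smult_zero_right: "smult c 0 = (0 :: 'a::field freealg)"
  by (rule poly_mapping_eqI) (simp add: lookup_smult)

lemma smult_sum: "smult c (\<Sum>i\<in>I. f i) = (\<Sum>i\<in>I. smult c (f i) :: 'a::field freealg)"
  by (rule poly_mapping_eqI) (simp add: lookup_smult lookup_sum sum_distrib_left)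

section \<open>The subalgebra \<open>U\<close>\<close>

lemma subalgebra_U: "qshuffle_subalgebra q (U q)"
  unfolding U_def by (rule hull_in) (auto simp: qshuffle_subalgebra_def)

lemma U_letter: "word [a] \<in> U q"
  using hull_inc[of _ "{word [X], word [Y]}" "qshuffle_subalgebra q"]
  unfolding U_def by (cases a) auto

lemma U_one: "word [] \<in> U q"
  using subalgebra_U[of q] by (simp add: qshuffle_subalgebra_def flip: one_freealg)

lemma U_add: "f \<in> U q \<Longrightarrow> g \<in> U q \<Longrightarrow> f + g \<in> U q"
  using subalgebra_U[of q] by (simp add: qshuffle_subalgebra_def)

lemma U_smult: "f \<in> U q \<Longrightarrow> smult c f \<in> U q"
  using subalgebra_U[of q] by (simp add: qshuffle_subalgebra_def)

lemma U_qshuffle_words: "word u \<in> U q \<Longrightarrow> word v \<in> U q \<Longrightarrow> qshuffle_words q u v \<in> U q"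
  using subalgebra_U[of q] unfolding qshuffle_subalgebra_def by (metis qshuffle_word_word)

lemma U_zero: "(0 :: 'a::field freealg) \<in> U q"
proof -
  have "smult 0 (word []) = (0 :: 'a freealg)"
    by (rule poly_mapping_eqI) (simp add: lookup_smult)
  then show ?thesis
    using U_smult[OF U_one, of 0 q] by simp
qed

lemma U_sum: "(\<And>i. i \<in> I \<Longrightarrow> f i \<in> U q) \<Longrightarrow> sum f I \<in> U q"
  by (induction I rule: infinite_finite_induct) (auto intro: U_zero U_add)

section \<open>The antipode identity\<close>

primrec sgn_letter :: "letter \<Rightarrow> int" where
  "sgn_letter X = 1"
| "sgn_letter Y = - 1"

definition wt :: "letter list \<Rightarrow> int" where
  "wt w = (\<Sum>a\<leftarrow>w. sgn_letter a)"

lemma wt_simps [simp]: "wt [] = 0" "wt (a # w) = sgn_letter a + wt w" "wt (u @ v) = wt u + wt v"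
  by (simp_all add: wt_def)

lemma wt_rev [simp]: "wt (rev w) = wt w"
  by (induction w) simp_all

text \<open>The form has rank one, so the exponents of \<open>q\<close> in a shuffle depend on words
  only through their weights \<open>wt\<close>.\<close>

lemma pairing_eq: "pairing a b = 2 * sgn_letter a * sgn_letter b"
  by (cases a; cases b) (simp_all add: pairing_def)

lemma sum_pairing: "(\<Sum>c\<leftarrow>w. pairing b c) = 2 * sgn_letter b * wt w"
  by (induction w) (simp_all add: pairing_eq distrib_left)

lemma sgn_letter_square [simp]: "sgn_letter a * sgn_letter a = 1"
  by (cases a) auto

text \<open>The exponent is \<open>\<Sum>\<^sub>i\<^sub><\<^sub>j \<langle>v\<^sub>i, v\<^sub>j\<rangle>\<close>, so \<open>v \<mapsto> antipode_coeff q v \<cdot> rev v\<close> is the braided antipode.\<close>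

definition antipode_coeff :: "'a::field \<Rightarrow> letter list \<Rightarrow> 'a" where
  "antipode_coeff q v = (- 1) ^ length v * q powi (wt v ^ 2 - int (length v))"

lemma antipode_coeff_square:
  fixes q :: "'a::field"
  assumes "q \<noteq> 0"
  shows "(antipode_coeff q w)\<^sup>2 = q powi (2 * ((wt w)\<^sup>2 - int (length w)))"
proof -
  define e where "e = (wt w)\<^sup>2 - int (length w)"
  have "((- 1) ^ length w :: 'a)\<^sup>2 = 1"
    by (simp only: power2_eq_square minus_one_mult_self)
  moreover have "(q powi e)\<^sup>2 = q powi (2 * e)"
    by (simp only: power2_eq_square mult_2 power_int_add[OF disjI1[OF assms]])
  ultimately show ?thesis
    by (simp only: antipode_coeff_def power_mult_distrib e_def[symmetric] mult_1)
qed

text \<open>The summand that cutting \<open>w\<close> after \<open>k\<close> letters contributes to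
  the convolution of the identity with the antipode.\<close>

definition antipode_term :: "'a::field \<Rightarrow> letter list \<Rightarrow> nat \<Rightarrow> 'a freealg" where
  "antipode_term q w k =
     smult (antipode_coeff q (drop k w)) (qshuffle_words q (take k w) (rev (drop k w)))"

text \<open>The new pairs are those of \<open>z\<close> with the letters of \<open>v\<close>; they
  add \<open>2 * sgn_letter z * wt v\<close> to the exponent.\<close>

lemma antipode_coeff_snoc:
  assumes "q \<noteq> 0"
  shows "antipode_coeff q (v @ [z]) = - antipode_coeff q v * q powi (2 * sgn_letter z * wt v)"
proof -
  have "wt (v @ [z]) ^ 2 - int (length (v @ [z])) = (wt v ^ 2 - int (length v)) + 2 * sgn_letter z * wt v"
    by (simp add: power2_eq_square algebra_simps)
  then show ?thesis
    unfolding antipode_coeff_def by (simp only: power_int_add[OF disjI1[OF assms]]) simp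
qed

text \<open>The shuffle begins with \<open>a\<close> or with \<open>z\<close>, the first letter of
  the reversed right part. In the second case the twist by the left part and the change of
  \<open>antipode_coeff\<close> combine to a scalar that does not depend on \<open>k\<close>, so it
  can be pulled out of a sum over cuts.\<close>

lemma antipode_term_step:
  fixes q :: "'a::field"
  assumes "q \<noteq> 0" and k: "k \<le> length m"
  shows "antipode_term q (a # m @ [z]) (Suc k) =
    word [a] * antipode_term q (m @ [z]) k +
    smult (- (q powi (2 * sgn_letter z * wt (a # m)))) (word [z] * antipode_term q (a # m) (Suc k))"
proof -
  define u v where "u = take k m" and "v = drop k m"
  have m: "wt m = wt u + wt v"
    by (metis append_take_drop_id u_def v_def wt_simps(3))
  have "antipode_coeff q (v @ [z]) * q powi (2 * sgn_letter z * wt (a # u))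
    = - (q powi (2 * sgn_letter z * wt (a # m))) * antipode_coeff q v"
    using assms by (simp add: antipode_coeff_snoc m algebra_simps flip: power_int_add)
  then show ?thesis
    using k by (simp add: antipode_term_def letter_times_smult smult_add_right smult_smult sum_pairing
      distrib_left flip: u_def v_def del: sum_list.Cons list.map)
qed

lemma antipode_term_first:
  fixes q :: "'a::field"
  assumes "q \<noteq> 0"
  shows "antipode_term q (a # m @ [z]) 0 =
    smult (- (q powi (2 * sgn_letter z * wt (a # m)))) (word [z] * antipode_term q (a # m) 0)"
  using antipode_coeff_snoc[OF assms, of "a # m" z]
  by (simp add: antipode_term_def letter_times_smult smult_smult letter_times_word mult.commute)

lemma antipode_term_length: "antipode_term q w (length w) = word w"
  by (cases w) (simp_all add: antipode_term_def antipode_coeff_def smult_one)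

text \<open>Sorting by leading letter turns the sum for \<open>a # m @ [z]\<close> into
  \<open>a\<close> times the sum for \<open>m @ [z]\<close> plus a multiple of \<open>z\<close>
  times the sum for \<open>a # m\<close>; both vanish by induction on the length.\<close>

lemma antipode_sum:
  fixes q :: "'a::field"
  assumes q: "q \<noteq> 0" and "w \<noteq> []"
  shows "(\<Sum>k\<le>length w. antipode_term q w k) = 0"
  using \<open>w \<noteq> []\<close>
proof (induction "length w" arbitrary: w rule: less_induct)
  case less
  obtain a w' where w': "w = a # w'" using less.prems by (cases w) auto
  show ?case
  proof (cases w' rule: rev_cases)
    case Nil
    show ?thesis
      by (rule poly_mapping_eqI)
        (cases a; simp add: w' Nil antipode_term_def antipode_coeff_def lookup_smult lookup_add lookup_word)
  next
    case (snoc m z)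
    define C where "C = - (q powi (2 * sgn_letter z * wt (a # m)))"
    \<comment> \<open>The extreme cuts are split off: one factor is trivial there, so only one
      leading letter occurs.\<close>
    have "(\<Sum>k\<le>length w. antipode_term q w k) = antipode_term q w 0
       + (\<Sum>k\<le>length m. antipode_term q w (Suc k)) + antipode_term q w (length w)"
      unfolding w' snoc length_Cons length_append_singleton
      by (subst sum.atMost_Suc, subst sum.atMost_Suc_shift, rule refl)
    also have "(\<Sum>k\<le>length m. antipode_term q w (Suc k)) =
       (\<Sum>k\<le>length m. word [a] * antipode_term q (m @ [z]) k) +
       (\<Sum>k\<le>length m. smult C (word [z] * antipode_term q (a # m) (Suc k)))"
      by (simp add: w' snoc antipode_term_step[OF q] C_def sum.distrib)
    also have "antipode_term q w (length w) = word [a] * antipode_term q (m @ [z]) (length (m @ [z]))"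
      by (simp only: antipode_term_length letter_times_word w' snoc)
    also have "antipode_term q w 0 = smult C (word [z] * antipode_term q (a # m) 0)"
      using antipode_term_first[OF q] by (simp add: w' snoc C_def)
    also have "smult C (word [z] * antipode_term q (a # m) 0) +
        ((\<Sum>k\<le>length m. word [a] * antipode_term q (m @ [z]) k) +
         (\<Sum>k\<le>length m. smult C (word [z] * antipode_term q (a # m) (Suc k)))) +
        word [a] * antipode_term q (m @ [z]) (length (m @ [z])) =
        word [a] * (\<Sum>k\<le>length (m @ [z]). antipode_term q (m @ [z]) k) +
        smult C (word [z] * (\<Sum>k\<le>length (a # m). antipode_term q (a # m) k))"
      unfolding length_Cons length_append_singleton sum.atMost_Suc_shift[of "antipode_term q (a # m)"]
      by (simp add: sum_distrib_left smult_sum smult_add_right distrib_left add_ac)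
    also have "\<dots> = 0"
      using less.hyps[of "m @ [z]"] less.hyps[of "a # m"]
      by (simp add: w' snoc smult_zero_right del: sum.atMost_Suc)
    finally show ?thesis .
  qed
qed

section \<open>The q-Serre relations\<close>

definition deriv_letter :: "letter \<Rightarrow> (letter list \<Rightarrow> 'a) \<Rightarrow> letter list \<Rightarrow> 'a" where
  "deriv_letter a f = (\<lambda>u. f (a # u))"

text \<open>The twist in the Leibniz rule: a letter \<open>a\<close> taken from the right factor
  passes the whole left factor.\<close>

definition torus :: "'a::field \<Rightarrow> letter \<Rightarrow> (letter list \<Rightarrow> 'a) \<Rightarrow> letter list \<Rightarrow> 'a" where
  "torus q a f = (\<lambda>u. q powi (\<Sum>c\<leftarrow>u. pairing a c) * f u)"

definition scale_fun :: "'a::field \<Rightarrow> (letter list \<Rightarrow> 'a) \<Rightarrow> letter list \<Rightarrow> 'a" where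
  "scale_fun c f = (\<lambda>u. c * f u)"

text \<open>The dual description of the \<open>q\<close>-shuffle product, by recursion on the word whose coefficient is
  taken; it makes sense for arbitrary, not finitely supported, coefficient functions.\<close>

primrec shuffle_fun :: "'a::field \<Rightarrow> (letter list \<Rightarrow> 'a) \<Rightarrow> (letter list \<Rightarrow> 'a) \<Rightarrow> letter list \<Rightarrow> 'a" where
  "shuffle_fun q f g [] = f [] * g []"
| "shuffle_fun q f g (a # w) =
     shuffle_fun q (deriv_letter a f) g w + shuffle_fun q (torus q a f) (deriv_letter a g) w"

lemma deriv_letter_torus:
  "q \<noteq> 0 \<Longrightarrow> deriv_letter b (torus q a f) = scale_fun (q powi pairing a b) (torus q a (deriv_letter b f))"
  by (simp add: fun_eq_iff deriv_letter_def torus_def scale_fun_def power_int_add)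

lemma deriv_letter_scale: "deriv_letter b (scale_fun c f) = scale_fun c (deriv_letter b f)"
  by (simp add: deriv_letter_def scale_fun_def)

lemma torus_scale: "torus q b (scale_fun c f) = scale_fun c (torus q b f)"
  by (simp add: torus_def scale_fun_def fun_eq_iff)

text \<open>\<open>X\<close> and \<open>Y\<close> pair oppositely with every letter.\<close>

lemma torus_inverse:
  assumes "q \<noteq> 0" and "a \<noteq> b"
  shows "torus q a (torus q b f) = f"
proof -
  have "pairing a c + pairing b c = 0" for c
    using assms(2) by (cases a; cases b; cases c) (auto simp: pairing_def)
  then have "(\<Sum>c\<leftarrow>u. pairing a c) + (\<Sum>c\<leftarrow>u. pairing b c) = 0" for u
    by (simp flip: sum_list_addf)
  then show ?thesis
    using assms(1) by (simp add: fun_eq_iff torus_def flip: power_int_add mult.assoc)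
qed

lemma shuffle_scale_left: "shuffle_fun q (scale_fun c f) g w = c * shuffle_fun q f g w"
  by (induction w arbitrary: f g)
    (simp_all add: deriv_letter_scale torus_scale algebra_simps, simp add: scale_fun_def)

lemma shuffle_scale_right: "shuffle_fun q f (scale_fun c g) w = c * shuffle_fun q f g w"
  by (induction w arbitrary: f g)
    (simp_all add: deriv_letter_scale torus_scale algebra_simps, simp add: scale_fun_def)

lemma shuffle_add_left:
  "shuffle_fun q (\<lambda>u. f u + f' u) g w = shuffle_fun q f g w + shuffle_fun q f' g w"
  by (induction w arbitrary: f f' g) (simp_all add: deriv_letter_def torus_def algebra_simps)

lemma shuffle_add_right:
  "shuffle_fun q f (\<lambda>u. g u + g' u) w = shuffle_fun q f g w + shuffle_fun q f g' w"
  by (induction w arbitrary: f g g') (simp_all add: deriv_letter_def torus_def algebra_simps)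

lemma shuffle_zero_left: "shuffle_fun q (\<lambda>u. 0) g w = 0"
  using shuffle_scale_left[of q 0 "\<lambda>u. 0" g w] by (simp add: scale_fun_def)

lemma shuffle_zero_right: "shuffle_fun q f (\<lambda>u. 0) w = 0"
  using shuffle_scale_right[of q f 0 "\<lambda>u. 0" w] by (simp add: scale_fun_def)

lemma shuffle_sum_left: "shuffle_fun q (\<lambda>u. \<Sum>i\<in>I. f i u) g w = (\<Sum>i\<in>I. shuffle_fun q (f i) g w)"
  by (induction I rule: infinite_finite_induct) (simp_all add: shuffle_zero_left shuffle_add_left)

lemma shuffle_sum_right: "shuffle_fun q f (\<lambda>u. \<Sum>i\<in>I. g i u) w = (\<Sum>i\<in>I. shuffle_fun q f (g i) w)"
  by (induction I rule: infinite_finite_induct) (simp_all add: shuffle_zero_right shuffle_add_right)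

text \<open>The quantum integer [3], the middle coefficient of the cubic q-Serre relation.\<close>

definition three_q :: "'a::field \<Rightarrow> 'a" where
  "three_q q = q^2 + 1 + inverse (q^2)"

definition serre :: "'a::field \<Rightarrow> letter \<Rightarrow> letter \<Rightarrow> (letter list \<Rightarrow> 'a) \<Rightarrow> letter list \<Rightarrow> 'a" where
  "serre q a b f = (\<lambda>w. f (a # a # a # b # w) - three_q q * f (a # a # b # a # w)
     + three_q q * f (a # b # a # a # w) - f (b # a # a # a # w))"

text \<open>In this form linearity of the shuffle applies. The outermost derivative reads the last
  letter, so the order is reversed.\<close>

lemma serre_decomp:
  "serre q a b f = (\<lambda>w.
     deriv_letter b (deriv_letter a (deriv_letter a (deriv_letter a f))) w
     + scale_fun (- three_q q) (deriv_letter a (deriv_letter b (deriv_letter a (deriv_letter a f)))) w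
     + scale_fun (three_q q) (deriv_letter a (deriv_letter a (deriv_letter b (deriv_letter a f)))) w
     + scale_fun (-1) (deriv_letter a (deriv_letter a (deriv_letter a (deriv_letter b f)))) w)"
  by (simp add: serre_def deriv_letter_def scale_fun_def fun_eq_iff)

lemma shuffle_serre_left:
  "shuffle_fun q (serre q a b f) g w =
     shuffle_fun q (deriv_letter b (deriv_letter a (deriv_letter a (deriv_letter a f)))) g w
     - three_q q * shuffle_fun q (deriv_letter a (deriv_letter b (deriv_letter a (deriv_letter a f)))) g w
     + three_q q * shuffle_fun q (deriv_letter a (deriv_letter a (deriv_letter b (deriv_letter a f)))) g w
     - shuffle_fun q (deriv_letter a (deriv_letter a (deriv_letter a (deriv_letter b f)))) g w"
  unfolding serre_decomp shuffle_add_left shuffle_scale_left by simp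

lemma shuffle_serre_right:
  "shuffle_fun q f (serre q a b g) w =
     shuffle_fun q f (deriv_letter b (deriv_letter a (deriv_letter a (deriv_letter a g)))) w
     - three_q q * shuffle_fun q f (deriv_letter a (deriv_letter b (deriv_letter a (deriv_letter a g)))) w
     + three_q q * shuffle_fun q f (deriv_letter a (deriv_letter a (deriv_letter b (deriv_letter a g)))) w
     - shuffle_fun q f (deriv_letter a (deriv_letter a (deriv_letter a (deriv_letter b g)))) w"
  unfolding serre_decomp shuffle_add_right shuffle_scale_right by simp

text \<open>Four applications of the Leibniz rule. If all derivatives act on \<open>g\<close>, then
  \<open>f\<close> is twisted three times by \<open>a\<close> and once by \<open>b\<close>, which
  leaves two twists by \<open>a\<close>. The mixed terms cancel by the value of
  \<open>three_q\<close>.\<close>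

lemma serre_shuffle:
  assumes q: "q \<noteq> 0" and ab: "a \<noteq> b"
  shows "serre q a b (shuffle_fun q f g) w =
    shuffle_fun q (serre q a b f) g w + shuffle_fun q (torus q a (torus q a f)) (serre q a b g) w"
  unfolding shuffle_serre_left shuffle_serre_right
  unfolding serre_def shuffle_fun.simps
  \<comment> \<open>Derivatives are moved inside the torus actions and scalars pulled out, so that
    equal mixed terms can be collected.\<close>
  unfolding torus_inverse[OF q ab] torus_inverse[OF q not_sym[OF ab]] deriv_letter_torus[OF q]
    deriv_letter_scale torus_scale shuffle_scale_left shuffle_scale_right
  using ab not_sym[OF ab]
  by (simp add: pairing_def power_int_minus q) (simp add: three_q_def field_simps q)

section \<open>Functions satisfying the q-Serre relations\<close>

text \<open>The prefix \<open>p\<close> imposes the relation at every position, which makes the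
  property stable under \<open>deriv_letter\<close>.\<close>

definition serre_free :: "'a::field \<Rightarrow> (letter list \<Rightarrow> 'a) \<Rightarrow> bool" where
  "serre_free q f \<longleftrightarrow> (\<forall>p a b w. a \<noteq> b \<longrightarrow> serre q a b (\<lambda>u. f (p @ u)) w = 0)"

lemma serre_free_deriv:
  assumes "serre_free q f"
  shows "serre_free q (deriv_letter c f)"
  unfolding serre_free_def
proof (intro allI impI)
  fix p a b w assume "a \<noteq> (b :: letter)"
  then show "serre q a b (\<lambda>u. deriv_letter c f (p @ u)) w = 0"
    using assms[unfolded serre_free_def, rule_format, of a b "c # p" w] by (simp add: deriv_letter_def)
qed

text \<open>The four words in a q-Serre expression have the same letters, so the torus scales them
  by a common power of \<open>q\<close>.\<close>

lemma serre_free_torus: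
  assumes q: "q \<noteq> 0" and f: "serre_free q f"
  shows "serre_free q (torus q c f)"
  unfolding serre_free_def
proof (intro allI impI)
  fix p a b w assume "a \<noteq> (b :: letter)"
  define e where "e = (\<Sum>d\<leftarrow>p. pairing c d) + (pairing c a + (pairing c a + (pairing c a
    + (pairing c b + (\<Sum>d\<leftarrow>w. pairing c d)))))"
  have "serre q a b (\<lambda>u. torus q c f (p @ u)) w = q powi e * serre q a b (\<lambda>u. f (p @ u)) w"
    unfolding serre_def torus_def by (simp add: add_ac right_diff_distrib distrib_left mult.left_commute e_def)
  then show "serre q a b (\<lambda>u. torus q c f (p @ u)) w = 0"
    using f \<open>a \<noteq> b\<close> by (simp add: serre_free_def)
qed

lemma serre_add: "serre q a b (\<lambda>u. f u + g u) w = serre q a b f w + serre q a b g w"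
  by (simp add: serre_def algebra_simps)

lemma serre_scale: "serre q a b (\<lambda>u. c * f u) w = c * serre q a b f w"
  by (simp add: serre_def algebra_simps)

text \<open>Each letter of the prefix is absorbed by the Leibniz rule, whose summands are again
  shuffles of functions with the property. At the empty prefix the twisted derivation kills both
  factors.\<close>

lemma serre_free_shuffle:
  assumes q: "q \<noteq> 0" and "serre_free q f" "serre_free q g"
  shows "serre_free q (shuffle_fun q f g)"
  unfolding serre_free_def
proof (intro allI impI)
  fix p a b w assume ab: "a \<noteq> (b :: letter)"
  show "serre q a b (\<lambda>u. shuffle_fun q f g (p @ u)) w = 0"
    using assms(2,3)
  proof (induction p arbitrary: f g)
    case Nil
    have "serre q a b f = (\<lambda>_. 0)" "serre q a b g = (\<lambda>_. 0)"
      using Nil[unfolded serre_free_def, rule_format, of a b "[]"] ab by (simp_all add: fun_eq_iff)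
    then show ?case
      using serre_shuffle[OF q ab, of f g w] by (simp add: shuffle_zero_left shuffle_zero_right)
  next
    case (Cons c p)
    then show ?case
      by (simp add: serre_add serre_free_deriv serre_free_torus[OF q])
  qed
qed

lemma serre_free_add: "serre_free q f \<Longrightarrow> serre_free q g \<Longrightarrow> serre_free q (\<lambda>u. f u + g u)"
  by (simp add: serre_free_def serre_add)

lemma serre_free_scale: "serre_free q f \<Longrightarrow> serre_free q (\<lambda>u. c * f u)"
  by (simp add: serre_free_def serre_scale)

section \<open>From coefficient functions back to the free algebra\<close>

abbreviation word_coeff :: "letter list \<Rightarrow> letter list \<Rightarrow> 'a::field" where
  "word_coeff u \<equiv> Poly_Mapping.lookup (word u)"

lemma deriv_letter_word: "deriv_letter c (word_coeff (a # u)) = scale_fun (if c = a then 1 else 0) (word_coeff u)"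
  by (auto simp: deriv_letter_def scale_fun_def fun_eq_iff lookup_word)

lemma deriv_letter_word_Nil: "deriv_letter c (word_coeff []) = (\<lambda>_. 0)"
  by (auto simp: deriv_letter_def fun_eq_iff lookup_word)

lemma torus_word: "torus q c (word_coeff u) = scale_fun (q powi (\<Sum>d\<leftarrow>u. pairing c d)) (word_coeff u)"
  by (auto simp: torus_def scale_fun_def fun_eq_iff lookup_word)

lemma shuffle_Nil_left: "shuffle_fun q (word_coeff []) g w = g w"
  by (induction w arbitrary: g)
    (simp_all add: deriv_letter_word_Nil torus_word shuffle_scale_left shuffle_zero_left,
      simp_all add: lookup_word deriv_letter_def)

lemma shuffle_Nil_right: "shuffle_fun q f (word_coeff []) w = f w"
  by (induction w arbitrary: f)
    (simp_all add: deriv_letter_word_Nil shuffle_zero_right, simp_all add: lookup_word deriv_letter_def)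

lemma lookup_qshuffle_words:
  "Poly_Mapping.lookup (qshuffle_words q u v) w = shuffle_fun q (word_coeff u) (word_coeff v) w"
proof (induction q u v arbitrary: w rule: qshuffle_words.induct)
  case (3 q a u b v)
  show ?case
  proof (cases w)
    case Nil
    then show ?thesis
      by (simp add: lookup_add lookup_smult lookup_letter_times lookup_word)
  next
    case (Cons c w')
    have "Poly_Mapping.lookup (qshuffle_words q (a # u) (b # v)) (c # w') =
        (if c = a then 1 else 0) * Poly_Mapping.lookup (qshuffle_words q u (b # v)) w' +
        q powi (\<Sum>d\<leftarrow>a # u. pairing b d) *
          ((if c = b then 1 else 0) * Poly_Mapping.lookup (qshuffle_words q (a # u) v) w')"
      by (simp only: qshuffle_words.simps lookup_add lookup_smult lookup_letter_times list.case) simp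
    also have "\<dots> = shuffle_fun q (word_coeff (a # u)) (word_coeff (b # v)) (c # w')"
      unfolding shuffle_fun.simps deriv_letter_word torus_word shuffle_scale_left shuffle_scale_right "3.IH"
      \<comment> \<open>The twists by \<open>c\<close> and by \<open>b\<close> may differ only if
        \<open>c\<close> is not \<open>b\<close>, and then the term vanishes.\<close>
      by (cases "c = b") simp_all
    finally show ?thesis
      unfolding Cons .
  qed
qed (simp_all add: shuffle_Nil_left shuffle_Nil_right)

text \<open>A finite expansion into words, which lets the formula for two words extend
  bilinearly.\<close>

lemma lookup_eq_sum_keys:
  "Poly_Mapping.lookup f = (\<lambda>w. \<Sum>u\<in>Poly_Mapping.keys f. scale_fun (Poly_Mapping.lookup f u) (word_coeff u) w)"
  by (auto simp: fun_eq_iff scale_fun_def lookup_word in_keys_iff if_distrib cong: if_cong)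

lemma lookup_qshuffle:
  "Poly_Mapping.lookup (qshuffle q f g) w = shuffle_fun q (Poly_Mapping.lookup f) (Poly_Mapping.lookup g) w"
proof -
  have left: "shuffle_fun q (Poly_Mapping.lookup f) h w =
      (\<Sum>u\<in>Poly_Mapping.keys f. Poly_Mapping.lookup f u * shuffle_fun q (word_coeff u) h w)" for h
    by (subst lookup_eq_sum_keys, unfold shuffle_sum_left shuffle_scale_left, rule refl)
  have right: "shuffle_fun q h (Poly_Mapping.lookup g) w =
      (\<Sum>v\<in>Poly_Mapping.keys g. Poly_Mapping.lookup g v * shuffle_fun q h (word_coeff v) w)" for h
    by (subst lookup_eq_sum_keys, unfold shuffle_sum_right shuffle_scale_right, rule refl)
  show ?thesis
    unfolding left
    unfolding right qshuffle_def lookup_sum lookup_smult lookup_qshuffle_words sum_distrib_left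
    by (simp only: mult.assoc)
qed

lemma U_subset_serre_free:
  fixes q :: "'a::field"
  assumes q: "q \<noteq> 0"
  shows "U q \<subseteq> {f. serre_free q (Poly_Mapping.lookup f)}"
  unfolding U_def
proof (rule hull_minimal)
  \<comment> \<open>A q-Serre expression only evaluates coefficients at words of length at least
    four.\<close>
  have letters: "serre_free q (word_coeff u)" if "length u < 4" for u
    using that by (auto simp: serre_free_def serre_def lookup_word)
  then show "{word [X], word [Y]} \<subseteq> {f. serre_free q (Poly_Mapping.lookup f)}"
    by auto
  show "qshuffle_subalgebra q {f. serre_free q (Poly_Mapping.lookup f)}"
    unfolding qshuffle_subalgebra_def
  proof (intro conjI ballI allI)
    show "1 \<in> {f. serre_free q (Poly_Mapping.lookup f)}"
      using letters[of "[]"] by (simp add: one_freealg)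
  next
    fix f g :: "'a freealg"
    assume fg: "f \<in> {f. serre_free q (Poly_Mapping.lookup f)}" "g \<in> {f. serre_free q (Poly_Mapping.lookup f)}"
    then show "f + g \<in> {f. serre_free q (Poly_Mapping.lookup f)}"
      by (simp add: plus_poly_mapping.rep_eq serre_free_add)
    have "Poly_Mapping.lookup (qshuffle q f g) = shuffle_fun q (Poly_Mapping.lookup f) (Poly_Mapping.lookup g)"
      by (simp add: fun_eq_iff lookup_qshuffle)
    then show "qshuffle q f g \<in> {f. serre_free q (Poly_Mapping.lookup f)}"
      using fg serre_free_shuffle[OF q] by simp
  next
    fix c and f :: "'a freealg"
    assume "f \<in> {f. serre_free q (Poly_Mapping.lookup f)}"
    moreover have "Poly_Mapping.lookup (smult c f) = (\<lambda>w. c * Poly_Mapping.lookup f w)"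
      by (simp add: fun_eq_iff lookup_smult)
    ultimately show "smult c f \<in> {f. serre_free q (Poly_Mapping.lookup f)}"
      by (simp add: serre_free_scale)
  qed
qed

text \<open>Among four letters, an odd number of \<open>X\<close> means a split into three equal letters and one other,
  that is, one of the four monomials of a \<open>q\<close>-Serre relation.\<close>

definition even_windows :: "letter list \<Rightarrow> bool" where
  "even_windows w \<longleftrightarrow> (\<forall>p z s. w = p @ z @ s \<longrightarrow> length z = 4 \<longrightarrow> even (count_list z X))"

text \<open>At a window with an odd count, only one monomial of the relation has a nonzero
  coefficient in \<open>word w\<close>, so the relation would say that 1 or \<open>three_q q\<close>
  is zero.\<close>

lemma even_windows_of_U:
  assumes q: "q \<noteq> 0" "\<forall>m::nat. m \<ge> 1 \<longrightarrow> q ^ m \<noteq> 1" and "word w \<in> U q"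
  shows "even_windows w"
  unfolding even_windows_def
proof (intro allI impI)
  fix p z s assume w: "w = p @ z @ s" and z: "length z = 4"
  have S: "serre q a b (\<lambda>u. word_coeff w (p @ u)) s = 0" if "a \<noteq> b" for a b
    using U_subset_serre_free[OF q(1)] assms(3) that unfolding serre_free_def by auto
  have nz: "three_q q \<noteq> 0"
  proof
    assume "three_q q = 0"
    moreover have "q^4 + q^2 + 1 = q^2 * three_q q"
      using q(1) by (simp add: three_q_def algebra_simps flip: power_add)
    ultimately have "q^4 + q^2 + 1 = 0"
      by simp
    \<comment> \<open>\<open>q^6 - 1\<close> is the product of \<open>q^2 - 1\<close> and
      \<open>q^4 + q^2 + 1\<close>.\<close>
    then have "q ^ 6 = 1"
      by algebra
    then show False
      using q(2)[rule_format, of 6] by simp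
  qed
  obtain a b c d where z': "z = [a, b, c, d]"
    using z by (auto simp: eval_nat_numeral length_Suc_conv)
  show "even (count_list z X)"
    using S[of X Y] S[of Y X] nz unfolding w z'
    by (cases a; cases b; cases c; cases d) (simp_all add: serre_def lookup_word)
qed

section \<open>Words of period four\<close>

lemma even_windows_factor: "even_windows (p @ z @ s) \<Longrightarrow> even_windows z"
  unfolding even_windows_def by (metis append.assoc)

lemma even_windows_rev:
  assumes "even_windows w"
  shows "even_windows (rev w)"
  unfolding even_windows_def
proof (intro allI impI)
  fix p z s assume "rev w = p @ z @ s" and "length z = 4"
  then have "w = rev s @ rev z @ rev p"
    by (metis append.assoc rev_append rev_rev_ident)
  then show "even (count_list z X)"
    using assms \<open>length z = 4\<close> unfolding even_windows_def by (metis count_list_rev length_rev)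
qed

text \<open>The prefix of length \<open>n\<close> of the periodic word abcdabcd..., so that
  incomplete periods need no separate treatment.\<close>

fun cyclic :: "'a \<Rightarrow> 'a \<Rightarrow> 'a \<Rightarrow> 'a \<Rightarrow> nat \<Rightarrow> 'a list" where
  "cyclic a b c d 0 = []"
| "cyclic a b c d (Suc n) = a # cyclic b c d a n"

lemma length_cyclic [simp]: "length (cyclic a b c d n) = n"
  by (induction n arbitrary: a b c d) simp_all

definition even_block :: "letter \<Rightarrow> letter \<Rightarrow> letter \<Rightarrow> letter \<Rightarrow> bool" where
  "even_block a b c d \<longleftrightarrow> even (count_list [a, b, c, d] X)"

lemma even_block_unique: "even_block a b c d \<Longrightarrow> even_block e a b c \<Longrightarrow> e = d"
  by (cases a; cases b; cases c; cases d; cases e) (simp_all add: even_block_def)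

lemma even_block_exists: "\<exists>d. even_block a b c d"
  by (rule exI[of _ "if even (count_list [a, b, c] X) then Y else X"])
    (cases a; cases b; cases c; simp add: even_block_def)

text \<open>Letters are prepended one by one. Once three letters of the period are visible, parity
  forces the new letter to continue it to the left; for shorter words the period can still be
  chosen.\<close>

lemma cyclic_of_even_windows:
  "even_windows w \<Longrightarrow> \<exists>a b c d. even_block a b c d \<and> w = cyclic a b c d (length w)"
proof (induction w)
  case Nil
  show ?case
    using even_block_exists by fastforce
next
  case (Cons e w)
  have "even_windows w"
    using even_windows_factor[of "[e]" w "[]"] Cons.prems by simp
  then obtain a b c d where abcd: "even_block a b c d" and w: "w = cyclic a b c d (length w)"
    using Cons.IH by blast
  consider "length w = 0" | "length w = 1" | "length w = 2" | n where "length w = Suc (Suc (Suc n))"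
    by (metis One_nat_def Suc_1 not0_implies_Suc)
  then show ?case
  proof cases
    case 1
    then show ?thesis using even_block_exists[of e e e] by fastforce
  next
    case 2
    then have "w = [a]" using w by simp
    then show ?thesis using even_block_exists[of e a a] by fastforce
  next
    case 3
    then have "w = [a, b]" using w by (simp add: numeral_2_eq_2)
    then show ?thesis using even_block_exists[of e a b] by fastforce
  next
    case 4
    then have "e # w = [] @ [e, a, b, c] @ cyclic d a b c n" using w by simp
    then have "even_block e a b c"
      using Cons.prems[unfolded even_windows_def, rule_format, of "[]" "[e, a, b, c]"]
      by (simp add: even_block_def)
    then have "e = d" and "even_block d a b c"
      using abcd even_block_unique by blast+
    moreover have "e # w = cyclic e a b c (length (e # w))" if "e = d"
      using w that by simp
    ultimately show ?thesis by blast
  qed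
qed

text \<open>Every window is a rotation of the block and has the same letter count.\<close>

lemma even_windows_cyclic:
  assumes "even_block a b c d"
  shows "even_windows (cyclic a b c d n)"
proof -
  have "even (count_list z X)"
    if "cyclic a b c d n = p @ z @ s" "length z = 4" "even_block a b c d" for p z s
    using that
  proof (induction p arbitrary: a b c d n)
    case Nil
    then obtain x y u v where "z = [x, y, u, v]"
      by (auto simp: eval_nat_numeral length_Suc_conv)
    moreover have "length (cyclic a b c d n) = length (z @ s)"
      using Nil by simp
    then obtain k where "n = Suc (Suc (Suc (Suc k)))"
      using \<open>length z = 4\<close> by (auto simp: eval_nat_numeral)
    ultimately show ?case
      using Nil by (simp add: even_block_def)
  next
    case (Cons e p)
    then obtain k where "n = Suc k"
      by (cases n) auto
    moreover have "even_block b c d a"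
      using Cons.prems(3) by (simp add: even_block_def split: if_splits)
    ultimately show ?case
      using Cons by auto
  qed
  then show ?thesis
    using assms by (auto simp: even_windows_def)
qed

section \<open>Weights of periodic words\<close>

lemma wt_cyclic_add_4:
  "wt (cyclic a b c d (n + 4)) = wt (cyclic a b c d n) + (sgn_letter a + sgn_letter b + sgn_letter c + sgn_letter d)"
proof (induction n arbitrary: a b c d)
  case 0
  show ?case by (simp add: eval_nat_numeral)
next
  case (Suc n)
  then show ?case by (simp only: add_Suc cyclic.simps wt_simps add_ac)
qed

text \<open>This keeps the antipode exponent nonzero. A constant word has squared weight
  \<open>n^2\<close>. Otherwise a full period has weight zero, so the weight depends on
  \<open>n\<close> mod 4 only, and its square is 0, 1, 0 or 4, 1 for the remainders 0, 1, 2,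
  3.\<close>

lemma wt_cyclic_square:
  assumes "even_block a b c d" and "(wt (cyclic a b c d n))\<^sup>2 = int n"
  shows "n \<le> 1"
proof (cases "a = b \<and> b = c \<and> c = d")
  case True
  have "wt (cyclic a a a a n) = sgn_letter a * int n"
    by (induction n) (simp_all add: algebra_simps)
  then have "int n * int n = int n"
    using assms(2) True by (cases d) (auto simp: power2_eq_square)
  then show ?thesis by auto
next
  case False
  have zero: "sgn_letter a + sgn_letter b + sgn_letter c + sgn_letter d = 0"
    using assms(1) False by (cases a; cases b; cases c; cases d) (simp_all add: even_block_def)
  have period: "wt (cyclic a b c d (4 * m + r)) = wt (cyclic a b c d r)" for m r
  proof (induction m)
    case (Suc m)
    then show ?case
      using wt_cyclic_add_4[of a b c d "4 * m + r"] zero by (simp add: add_ac)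
  qed simp
  define m r where "m = n div 4" and "r = n mod 4"
  have n: "n = 4 * m + r" and "r < 4"
    by (simp_all add: m_def r_def)
  then consider "r = 0" | "r = 1" | "r = 2" | "r = 3"
    by linarith
  then show ?thesis
  proof cases
    case 1
    then show ?thesis using assms(2) period[of m 0] n by simp
  next
    case 2
    then show ?thesis using assms(2) period[of m 1] n by (cases a) auto
  next
    case 3
    then show ?thesis
      using assms(2) period[of m 2] n by (cases a; cases b) (auto simp: numeral_2_eq_2, presburger+)
  next
    case 4
    have "wt (cyclic a b c d 3) = - sgn_letter d"
      using zero by (simp add: numeral_3_eq_3)
    then show ?thesis
      using assms(2) period[of m 3] n 4 by (cases d) auto
  qed
qed

section \<open>Membership in \<open>U\<close> by induction on the length\<close>

text \<open>The extreme cuts in the antipode identity give \<open>word w\<close> and the multiple of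
  \<open>word (rev w)\<close>. Every other cut shuffles a shorter prefix with a reversed shorter
  suffix, hence the assumption on both \<open>z\<close> and \<open>rev z\<close>.\<close>

lemma U_antipode:
  fixes q :: "'a::field"
  assumes q: "q \<noteq> 0" and "w \<noteq> []"
    and U: "\<And>p z s. w = p @ z @ s \<Longrightarrow> length z < length w \<Longrightarrow> word z \<in> U q \<and> word (rev z) \<in> U q"
  shows "word w + smult (antipode_coeff q w) (word (rev w)) \<in> U q"
proof -
  obtain n where n: "length w = Suc n"
    using \<open>w \<noteq> []\<close> by (cases w) auto
  have mid: "antipode_term q w (Suc k) \<in> U q" if "k < n" for k
    unfolding antipode_term_def
    using U[of "[]" "take (Suc k) w" "drop (Suc k) w"] U[of "take (Suc k) w" "drop (Suc k) w" "[]"] that n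
    by (intro U_smult U_qshuffle_words) auto
  have "0 = antipode_term q w 0 + (\<Sum>k<n. antipode_term q w (Suc k)) + antipode_term q w (length w)"
    using antipode_sum[OF q \<open>w \<noteq> []\<close>]
    unfolding n sum.atMost_Suc[of _ n] sum.atMost_shift by (simp add: add.assoc)
  then have "word w + smult (antipode_coeff q w) (word (rev w)) = - (\<Sum>k<n. antipode_term q w (Suc k))"
    by (simp add: antipode_term_length) (simp add: antipode_term_def eq_neg_iff_add_eq_0 add_ac)
  also have "\<dots> = smult (- 1) (\<Sum>k<n. antipode_term q w (Suc k))"
    by (rule poly_mapping_eqI) (simp add: lookup_smult)
  also have "\<dots> \<in> U q"
    by (intro U_smult U_sum mid) simp
  finally show ?thesis .
qed

lemma power_int_neq_1:
  fixes q :: "'a::field"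
  assumes "q \<noteq> 0" and "\<forall>m::nat. m \<ge> 1 \<longrightarrow> q ^ m \<noteq> 1" and "e \<noteq> 0"
  shows "q powi e \<noteq> 1"
  using assms(3) assms(2)[rule_format, of "nat \<bar>e\<bar>"]
  by (cases "e > 0") (auto simp: power_int_def field_simps)

lemma U_of_even_windows:
  fixes q :: "'a::field"
  assumes q: "q \<noteq> 0" "\<forall>m::nat. m \<ge> 1 \<longrightarrow> q ^ m \<noteq> 1"
  shows "even_windows w \<Longrightarrow> word w \<in> U q"
proof (induction "length w" arbitrary: w rule: less_induct)
  case less
  consider "w = []" | a where "w = [a]" | "length w \<ge> 2"
    by (cases w rule: remdups_adj.cases) auto
  then show ?case
  proof cases
    case 3
    have U: "word z \<in> U q \<and> word (rev z) \<in> U q" if "length z < length w" "even_windows z" for z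
      using that less.hyps even_windows_rev by simp
    have "word w + smult (antipode_coeff q w) (word (rev w)) \<in> U q"
      using less.prems 3 by (intro U_antipode q U) (auto dest: even_windows_factor)
    moreover have "word (rev w) + smult (antipode_coeff q w) (word w) \<in> U q"
    proof -
      have "word (rev w) + smult (antipode_coeff q (rev w)) (word (rev (rev w))) \<in> U q"
      proof (intro U_antipode q U)
        show "rev w \<noteq> []" using 3 by auto
        show "length z < length w" if "length z < length (rev w)" for z :: "letter list"
          using that by simp
        show "even_windows z" if "rev w = p @ z @ s" for p z s
          using even_windows_rev[OF less.prems] that by (auto dest: even_windows_factor)
      qed
      \<comment> \<open>Length and weight are invariant under reversal, so both words have the same
        coefficient.\<close>
      then show ?thesis by (simp add: antipode_coeff_def)
    qed
    \<comment> \<open>This combination eliminates \<open>word (rev w)\<close>.\<close>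
    ultimately have "smult (inverse (1 - (antipode_coeff q w)\<^sup>2))
       ((word w + smult (antipode_coeff q w) (word (rev w))) +
        smult (- antipode_coeff q w) (word (rev w) + smult (antipode_coeff q w) (word w))) \<in> U q"
      by (intro U_smult[OF U_add[OF _ U_smult]])
    also have "smult (inverse (1 - (antipode_coeff q w)\<^sup>2))
       ((word w + smult (antipode_coeff q w) (word (rev w))) +
        smult (- antipode_coeff q w) (word (rev w) + smult (antipode_coeff q w) (word w))) = word w"
    proof -
      obtain a b c d where "even_block a b c d" "w = cyclic a b c d (length w)"
        using cyclic_of_even_windows[OF less.prems] by blast
      then have "(wt w)\<^sup>2 \<noteq> int (length w)"
        using wt_cyclic_square[of a b c d "length w"] 3 by auto
      then have "q powi (2 * ((wt w)\<^sup>2 - int (length w))) \<noteq> 1"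
        by (intro power_int_neq_1 q) simp
      moreover have "(antipode_coeff q w)\<^sup>2 = q powi (2 * ((wt w)\<^sup>2 - int (length w)))"
        by (rule antipode_coeff_square[OF q(1)])
      ultimately have "1 - (antipode_coeff q w)\<^sup>2 \<noteq> 0"
        by simp
      then show ?thesis
        by (intro poly_mapping_eqI) (simp add: lookup_smult lookup_add field_simps power2_eq_square)
    qed
    finally show ?thesis .
  qed (simp_all add: U_one U_letter)
qed

lemma in_U_iff_cyclic:
  fixes q :: "'a::field"
  assumes q: "q \<noteq> 0" "\<forall>m::nat. m \<ge> 1 \<longrightarrow> q ^ m \<noteq> 1"
  shows "word w \<in> U q \<longleftrightarrow> (\<exists>a b c d n. even_block a b c d \<and> w = cyclic a b c d n)"
  using even_windows_of_U[OF q] U_of_even_windows[OF q] cyclic_of_even_windows even_windows_cyclic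
  by metis

section \<open>Comparison with the explicit list\<close>

lemma wpow_0 [simp]: "u ^w 0 = []" and wpow_Suc [simp]: "u ^w Suc n = u @ u ^w n"
  by (simp_all add: wpow_def)

lemma wpow_1_cyclic: "[a] ^w n = cyclic a a a a n"
  by (induction n) simp_all

lemma wpow_2_cyclic:
  "[a, b] ^w n = cyclic a b a b (2 * n)"
  "[a, b] ^w n @ [a] = cyclic a b a b (Suc (2 * n))"
  by (induction n) simp_all

lemma wpow_4_cyclic: "[a, b, c, d] ^w n = cyclic a b c d (4 * n)"
  by (induction n) (simp_all add: eval_nat_numeral)

lemma wpow_4_append_cyclic:
  "[a, b, c, d] ^w n @ [a] = cyclic a b c d (Suc (4 * n))"
  "[a, b, c, d] ^w n @ [a, b] = cyclic a b c d (Suc (Suc (4 * n)))"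
  "[a, b, c, d] ^w n @ [a, b, c] = cyclic a b c d (Suc (Suc (Suc (4 * n))))"
  by (induction n) (simp_all add: eval_nat_numeral)

text \<open>An even block has the shape aaaa, abab, abba or aabb; the words are then sorted by
  length mod 2 for abab and mod 4 for the last two. The order is that of the final list, so that
  rewriting alone identifies the two.\<close>

lemma cyclic_even_block_iff:
  "(\<exists>a b c d n. even_block a b c d \<and> w = cyclic a b c d n) \<longleftrightarrow>
   (\<exists>n. w \<in> {
      cyclic X X X X n, cyclic Y Y Y Y n,
      cyclic X Y X Y (2 * (n + 1)), cyclic Y X Y X (2 * (n + 1)),
      cyclic X Y X Y (Suc (2 * n)), cyclic Y X Y X (Suc (2 * n)),
      cyclic X X Y Y (4 * (n + 1)), cyclic Y Y X X (4 * (n + 1)),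
      cyclic X X Y Y (Suc (Suc (4 * n))), cyclic Y Y X X (Suc (Suc (4 * n))),
      cyclic X Y Y X (Suc (Suc (Suc (4 * n)))), cyclic Y X X Y (Suc (Suc (Suc (4 * n)))),
      cyclic X Y Y X (Suc (4 * n)), cyclic Y X X Y (Suc (4 * n)),
      cyclic X X Y Y (Suc (Suc (Suc (4 * n)))), cyclic Y Y X X (Suc (Suc (Suc (4 * n)))),
      cyclic X X Y Y (Suc (4 * n)), cyclic Y Y X X (Suc (4 * n)),
      cyclic X Y Y X (Suc (Suc (4 * n))), cyclic Y X X Y (Suc (Suc (4 * n))),
      cyclic X Y Y X (4 * (n + 1)), cyclic Y X X Y (4 * (n + 1))})"
    (is "?cyc w \<longleftrightarrow> (\<exists>n. w \<in> ?L n)")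
proof
  assume "?cyc w"
  then obtain a b c d k where abcd: "even_block a b c d" and w: "w = cyclic a b c d k"
    by blast
  consider "a = b" "c = a" "d = a" | "a \<noteq> b" "c = a" "d = b" | "a \<noteq> b" "c = b" "d = a" | "a = b" "c = d" "c \<noteq> a"
    using abcd by (cases a; cases b; cases c; cases d) (simp_all add: even_block_def)
  moreover have k2: "k = 0 \<or> (\<exists>n. k = 2 * (n + 1) \<or> k = Suc (2 * n))"
    by presburger
  moreover have k4: "k = 0 \<or> (\<exists>n. k = Suc (4 * n) \<or> k = Suc (Suc (4 * n)) \<or>
      k = Suc (Suc (Suc (4 * n))) \<or> k = 4 * (n + 1))"
    by presburger
  ultimately show "\<exists>n. w \<in> ?L n"
  proof cases
    case 1
    then show ?thesis
      using w by (intro exI[of _ k]) (cases a; simp del: cyclic.simps)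
  next
    case 2
    consider "k = 0" | n where "k = 2 * (n + 1)" | n where "k = Suc (2 * n)"
      using k2 by blast
    then show ?thesis
    proof cases
      case 1
      \<comment> \<open>The empty word is listed as the constant word of length 0.\<close>
      then show ?thesis using w by (intro exI[of _ 0]) simp
    next
      case (2 n)
      with \<open>a \<noteq> b\<close> \<open>c = a\<close> \<open>d = b\<close> show ?thesis
        using w by (intro exI[of _ n]) (cases a; cases b; simp del: cyclic.simps)
    next
      case (3 n)
      with \<open>a \<noteq> b\<close> \<open>c = a\<close> \<open>d = b\<close> show ?thesis
        using w by (intro exI[of _ n]) (cases a; cases b; simp del: cyclic.simps)
    qed
  next
    case 3
    consider "k = 0" | n where "k \<in> {Suc (4 * n), Suc (Suc (4 * n)), Suc (Suc (Suc (4 * n))), 4 * (n + 1)}"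
      using k4 by blast
    then show ?thesis
    proof cases
      case 1
      then show ?thesis using w by (intro exI[of _ 0]) simp
    next
      case (2 n)
      with 3 show ?thesis
        using w by (intro exI[of _ n]) (cases a; cases b; auto simp del: cyclic.simps)
    qed
  next
    case 4
    consider "k = 0" | n where "k \<in> {Suc (4 * n), Suc (Suc (4 * n)), Suc (Suc (Suc (4 * n))), 4 * (n + 1)}"
      using k4 by blast
    then show ?thesis
    proof cases
      case 1
      then show ?thesis using w by (intro exI[of _ 0]) simp
    next
      case (2 n)
      with 4 show ?thesis
        using w by (intro exI[of _ n]) (cases a; cases c; auto simp del: cyclic.simps)
    qed
  qed
next
  have cycI: "?cyc w" if "w = cyclic a b c d n" "even_block a b c d" for a b c d n
    using that by blast
  assume "\<exists>n. w \<in> ?L n"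
  then obtain n where "w \<in> ?L n" ..
  then show "?cyc w"
    by (elim insertE emptyE) (erule cycI, simp add: even_block_def)+
qed

theorem theorem3p11:
  fixes q :: "'a::field_char_0" and w :: "letter list"
  assumes "q \<noteq> 0"
    and "\<forall>m::nat. m \<ge> 1 \<longrightarrow> q ^ m \<noteq> 1"
  shows "word w \<in> U q \<longleftrightarrow>
    (\<exists>n::nat. w \<in> {
      [X] ^w n, [Y] ^w n,
      [X,Y] ^w (n + 1), [Y,X] ^w (n + 1), [X,Y] ^w n @ [X], [Y,X] ^w n @ [Y],
      [X,X,Y,Y] ^w (n + 1), [Y,Y,X,X] ^w (n + 1),
      [X,X,Y,Y] ^w n @ [X,X], [Y,Y,X,X] ^w n @ [Y,Y],
      [X,Y,Y] @ [X,X,Y,Y] ^w n, [Y,X,X] @ [Y,Y,X,X] ^w n,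
      [X] @ [Y,Y,X,X] ^w n, [Y] @ [X,X,Y,Y] ^w n,
      [X,X,Y,Y] ^w n @ [X,X,Y], [Y,Y,X,X] ^w n @ [Y,Y,X],
      [X,X,Y,Y] ^w n @ [X], [Y,Y,X,X] ^w n @ [Y],
      [X] @ [Y,Y,X,X] ^w n @ [Y], [Y] @ [X,X,Y,Y] ^w n @ [X],
      [X,Y,Y] @ [X,X,Y,Y] ^w n @ [X], [Y,X,X] @ [Y,Y,X,X] ^w n @ [Y]})"
proof -
  have four: "Suc (Suc (Suc (Suc (4 * n)))) = 4 * (n + 1)" for n :: nat
    by simp
  show ?thesis
    unfolding in_U_iff_cyclic[OF assms] cyclic_even_block_iff
    \<comment> \<open>Powers with trailing letters are converted before bare powers. Leading letters
      are then folded in by \<open>cyclic.simps(2)\<close>, which rotates the period.\<close>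
    unfolding wpow_4_append_cyclic wpow_2_cyclic(2)
    unfolding wpow_4_cyclic wpow_2_cyclic(1) wpow_1_cyclic append_Cons append_Nil
      cyclic.simps(2)[symmetric] four
    by (rule refl)
qed

end
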